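(* There exists a Barański carpet $K$ such that $$\dim_{\mathrm H}\{x\in K:\dim_{\mathrm A}(K,x)=\dim_{\mathrm A} K\}<\dim_{\mathrm H} K.$$
   Context: **Barański carpets.** Let $\mathcal{I}$ be a finite index set with $\#\mathcal{I}\geq 2$. For $i\in\mathcal{I}$, $j\in\{1,2\}$ let $\beta_{i,j}\in(0,1)$, $d_{i,j}\in\mathbb{R}$, put $S_{i,j}(t)=\beta_{i,j}t+d_{i,j}$ and $T_i(x_1,x_2)=(S_{i,1}(x_1),S_{i,2}(x_2))$. The attractor $K$ is the unique non-empty compact set with $K=\bigcup_{i\in\mathcal{I}}T_i(K)$; it is assumed throughout that $K\subset[0,1]^2$. $K$ is a Barański carpet if: (1) $T_i((0,1)^2)\cap T_j((0,1)^2)=\varnothing$ for all $i\neq j$; (2) for all $i,j\in\mathcal{I}$ and $\ell\in\{1,2\}$ either $S_{i,\ell}((0,1))=S_{j,\ell}((0,1))$ or $S_{i,\ell}((0,1))\cap S_{j,\ell}((0,1))=\varnothing$. **Dimensions.** $\dim_{\mathrm H}$ is Hausdorff dimension. $N_r(F)$ is the smallest number of closed balls of radius $r$ needed to cover a bounded set $F$. For compact $K$, $$\dim_{\mathrm A} K=\inf\{s:\exists C>0\ \forall 0<r\leq R<1\ \forall x\in K,\ N_r(B(x,R)\cap K)\leq C(R/r)^s\},$$ and for $x\in K$ the pointwise Assouad dimension is $$\dim_{\mathrm A}(K,x)=\inf\{s:\exists C>0\ \exists\rho>0\ \forall 0<r\leq R<\rho,\ N_r(B(x,R)\cap K)\leq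 C(R/r)^s\}.$$ *)

theory Defs
  imports "HOL-Analysis.Analysis"
begin

(* |U|^s, with the conventions |{}|^s = 0 for all s and |U|^0 = 1 for U nonempty
   (note that 0 powr 0 = 0). *)
definition diam_pow :: "real \<Rightarrow> 'a::metric_space set \<Rightarrow> ennreal" where
  "diam_pow s U =
     (if U = {} then 0 else if s = 0 then 1 else ennreal (diameter U powr s))"

(* Boundedness is required explicitly because diameter is only meaningful for bounded sets. *)
definition hausdorff_premeasure ::
    "real \<Rightarrow> real \<Rightarrow> 'a::metric_space set \<Rightarrow> ennreal" where
  "hausdorff_premeasure s \<delta> F =
     (INF U \<in> {U :: nat \<Rightarrow> 'a set.
                 F \<subseteq> (\<Union>n. U n) \<and> (\<forall>n. bounded (U n) \<and> diameter (U n) \<le> \<delta>)}.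
        \<Sum>n. diam_pow s (U n))"

definition hausdorff_measure :: "real \<Rightarrow> 'a::metric_space set \<Rightarrow> ennreal" where
  "hausdorff_measure s F = (SUP \<delta>\<in>{0<..}. hausdorff_premeasure s \<delta> F)"

(* The empty set gets dimension 0. *)
definition hausdorff_dim :: "'a::metric_space set \<Rightarrow> ereal" where
  "hausdorff_dim F = (INF s \<in> {s. 0 \<le> s \<and> hausdorff_measure s F = 0}. ereal s)"

(* Only used for bounded F and r > 0, where the LEAST exists. Centres need not lie in F. *)
definition covering_number :: "real \<Rightarrow> 'a::heine_borel set \<Rightarrow> nat" where
  "covering_number r F =
     (LEAST n. \<exists>A. finite A \<and> card A = n \<and> F \<subseteq> (\<Union>a\<in>A. cball a r))"

definition assouad_dim :: "'a::heine_borel set \<Rightarrow> ereal" where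
  "assouad_dim K =
     (INF s \<in> {s. \<exists>C>0. \<forall>r R. 0 < r \<longrightarrow> r \<le> R \<longrightarrow> R < 1 \<longrightarrow>
                 (\<forall>x\<in>K. real (covering_number r (cball x R \<inter> K)) \<le> C * (R / r) powr s)}.
        ereal s)"

definition pointwise_assouad_dim :: "'a::heine_borel set \<Rightarrow> 'a \<Rightarrow> ereal" where
  "pointwise_assouad_dim K x =
     (INF s \<in> {s. \<exists>C>0. \<exists>\<rho>>0. \<forall>r R. 0 < r \<longrightarrow> r \<le> R \<longrightarrow> R < \<rho> \<longrightarrow>
                 real (covering_number r (cball x R \<inter> K)) \<le> C * (R / r) powr s}.
        ereal s)"

definition coord_map ::
    "('i \<Rightarrow> nat \<Rightarrow> real) \<Rightarrow> ('i \<Rightarrow> nat \<Rightarrow> real) \<Rightarrow> 'i \<Rightarrow> nat \<Rightarrow> real \<Rightarrow> real" where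
  "coord_map \<beta> d i j t = \<beta> i j * t + d i j"

definition plane_map ::
    "('i \<Rightarrow> nat \<Rightarrow> real) \<Rightarrow> ('i \<Rightarrow> nat \<Rightarrow> real) \<Rightarrow> 'i \<Rightarrow> real \<times> real \<Rightarrow> real \<times> real" where
  "plane_map \<beta> d i x = (coord_map \<beta> d i 1 (fst x), coord_map \<beta> d i 2 (snd x))"

(* For a finite nonempty family of contractions these conditions determine K uniquely. *)
definition is_attractor :: "'i set \<Rightarrow> ('i \<Rightarrow> 'a \<Rightarrow> 'a) \<Rightarrow> 'a::metric_space set \<Rightarrow> bool" where
  "is_attractor I T K \<longleftrightarrow> K \<noteq> {} \<and> compact K \<and> K = (\<Union>i\<in>I. T i ` K)"

definition baranski_system ::
    "'i set \<Rightarrow> ('i \<Rightarrow> nat \<Rightarrow> real) \<Rightarrow> ('i \<Rightarrow> nat \<Rightarrow> real) \<Rightarrow> (real \<times> real) set \<Rightarrow> bool" where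
  "baranski_system I \<beta> d K \<longleftrightarrow>
     finite I \<and> 2 \<le> card I \<and>
     (\<forall>i\<in>I. \<forall>j\<in>{1, 2}. 0 < \<beta> i j \<and> \<beta> i j < 1) \<and>
     is_attractor I (plane_map \<beta> d) K \<and>
     K \<subseteq> {0..1} \<times> {0..1} \<and>
     (\<forall>i\<in>I. \<forall>j\<in>I. i \<noteq> j \<longrightarrow>
        plane_map \<beta> d i ` ({0<..<1} \<times> {0<..<1}) \<inter>
        plane_map \<beta> d j ` ({0<..<1} \<times> {0<..<1}) = {}) \<and>
     (\<forall>i\<in>I. \<forall>j\<in>I. \<forall>l\<in>{1, 2}.
        coord_map \<beta> d i l ` {0<..<1} = coord_map \<beta> d j l ` {0<..<1} \<or>
        coord_map \<beta> d i l ` {0<..<1} \<inter> coord_map \<beta> d j l ` {0<..<1} = {})"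

(* Every finite index set can be relabelled by natural numbers, so nat suffices. *)
definition baranski_carpet :: "(real \<times> real) set \<Rightarrow> bool" where
  "baranski_carpet K \<longleftrightarrow> (\<exists>(I :: nat set) \<beta> d. baranski_system I \<beta> d K)"

end

theory Submission
  imports Defs "HOL-Library.Sublist"
begin

text \<open>
  The example has three maps. All of them contract heights by \<open>1/4\<close>. Two of them stand side by side in
  the bottom row \<open>[0, 1/4]\<close> and have width \<open>15/32\<close>; the third lies in the top row \<open>[3/4, 1]\<close> and has
  width \<open>1/16\<close>. The three columns fill \<open>[0, 1]\<close>, so the projection of \<open>K\<close> to the first axis is
  \<open>[0, 1]\<close> and \<open>dim\<^sub>H K \<ge> 1\<close> (\<open>projection_full\<close>, \<open>hausdorff_dim_ge_1_if_projection_full\<close>).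

  What drives the example is the shape of the cylinders, the images of \<open>K\<close> under words of length \<open>n\<close>. They all have
  height \<open>4 ^ (-n)\<close>. Around a point with Lebesgue-typical first coordinate they are wider than high for large \<open>n\<close>,
  since \<open>(15/32) powr (15/16) * (1/16) powr (1/16) > 1/4\<close>. The word consisting of \<open>n\<close> copies of the narrow map is
  an exception: its width is \<open>16 ^ (-n)\<close>. Inside a tall cylinder one sees at scale \<open>16 ^ (-n)\<close> nearly a product: horizontally
  the bottom row, whose dimension \<open>ln 2 / ln (32/15)\<close> is almost \<open>1\<close>, and vertically the
  projection of \<open>K\<close> to the second axis, a Cantor set of dimension \<open>1/2\<close>. Hence the Assouad dimension
  exceeds \<open>1\<close>; the bound \<open>6/5\<close> is convenient (\<open>product_like_piece\<close>, \<open>assouad_dim_ge\<close>).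

  A point that is eventually far from all tall cylinders does not see this product. A ball of radius
  \<open>R\<close> about such a point meets a bounded number of cylinders of width comparable to \<open>R\<close>
  (each column carries only one map), and each of these has height at most \<open>R\<close>. It is therefore
  the image of \<open>K\<close> under an \<open>R\<close>-Lipschitz map. But \<open>K\<close> has box dimension \<open>1\<close>: there are
  only \<open>3 ^ n \<le> 4 ^ n\<close> cylinders of height \<open>4 ^ (-n)\<close>, and their widths add up to \<open>1\<close>
  (\<open>affine_image_cover\<close>). So the pointwise dimension is at most \<open>1\<close> (\<open>pointwise_dim_le_1\<close>).

  The points at which the Assouad dimension is attained thus lie near infinitely many tall cylinders. A tall
  cylinder of level \<open>n\<close> has diameter comparable to \<open>4 ^ (-n)\<close>, and there are at most \<open>3 ^ n\<close> of them. So
  this set has Hausdorff dimension at most \<open>ln 3 / ln 4 < 4/5\<close> (\<open>often_near_tall_dim\<close>).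
\<close>

section \<open>Covering numbers and Hausdorff dimension\<close>

lemma covering_number_le_card:
  assumes "finite A" "F \<subseteq> (\<Union>a\<in>A. cball a r)"
  shows "covering_number r F \<le> card A"
  unfolding covering_number_def by (rule Least_le) (use assms in blast)

text \<open>
  A closed ball of radius \<open>r\<close> contains at most one point of a set whose points are more than
  \<open>2 * r\<close> apart.
\<close>
lemma card_separated_le_covering_number:
  fixes F :: "'a::heine_borel set"
  assumes "bounded F" "0 < r" "P \<subseteq> F"
    and sep: "\<And>p q. p \<in> P \<Longrightarrow> q \<in> P \<Longrightarrow> p \<noteq> q \<Longrightarrow> 2 * r < dist p q"
  shows "card P \<le> covering_number r F"
proof -
  have "compact (closure F)"
    using assms(1) by simp
  then obtain A where A: "finite A" "closure F \<subseteq> (\<Union>a\<in>A. ball a r)"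
    using assms(2) unfolding compact_eq_totally_bounded by blast
  have "F \<subseteq> (\<Union>a\<in>A. cball a r)"
    using A(2) closure_subset[of F] ball_subset_cball[of _ r] by blast
  then have ex: "\<exists>n A. finite A \<and> card A = n \<and> F \<subseteq> (\<Union>a\<in>A. cball a r)"
    using A(1) by blast
  obtain A where A: "finite A" "card A = covering_number r F" "F \<subseteq> (\<Union>a\<in>A. cball a r)"
    using LeastI_ex[OF ex] unfolding covering_number_def by blast
  have "\<forall>p\<in>P. \<exists>a\<in>A. p \<in> cball a r"
    using assms(3) A(3) by blast
  then obtain f where f: "\<And>p. p \<in> P \<Longrightarrow> f p \<in> A" "\<And>p. p \<in> P \<Longrightarrow> p \<in> cball (f p) r"
    by metis
  have "inj_on f P"
  proof (rule inj_onI, rule ccontr)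
    fix p q assume pq: "p \<in> P" "q \<in> P" "f p = f q" "p \<noteq> q"
    have "dist p q \<le> dist (f p) p + dist (f p) q"
      by (metis dist_commute dist_triangle2 dist_triangle)
    also have "\<dots> \<le> 2 * r"
      using f(2)[OF pq(1)] f(2)[OF pq(2)] pq(3) by simp
    finally show False
      using sep[OF pq(1,2,4)] by simp
  qed
  then have "card P \<le> card A"
    using f(1) A(1) by (metis card_inj_on_le image_subsetI)
  then show ?thesis
    using A(2) by simp
qed

text \<open>
  A set of diameter \<open>\<delta>\<close> projects into an interval of length \<open>2 * \<delta>\<close>, and
  \<open>\<delta> \<le> \<delta> powr s\<close> when \<open>\<delta> \<le> 1\<close> and \<open>s < 1\<close>. So the sums in the definition of the \<open>s\<close>-dimensional
  measure dominate half the Lebesgue measure of \<open>[0, 1]\<close>.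
\<close>
lemma hausdorff_dim_ge_1_if_projection_full:
  fixes F :: "(real \<times> real) set"
  assumes "{0..1} \<subseteq> fst ` F"
  shows "1 \<le> hausdorff_dim F"
proof -
  have "1 \<le> s" if s: "0 \<le> s" "hausdorff_measure s F = 0" for s
  proof (rule ccontr)
    assume "\<not> 1 \<le> s"
    have "ennreal (1/2) \<le> (\<Sum>n. diam_pow s (U n))"
      if U: "F \<subseteq> (\<Union>n. U n)" "\<And>n. bounded (U n)" "\<And>n. diameter (U n) \<le> 1" for U :: "nat \<Rightarrow> _"
    proof -
      define J where
        "J n = (if U n = {} then {} else
                 let a = fst (SOME p. p \<in> U n) in {a - diameter (U n) .. a + diameter (U n)})" for n
      have J_cover: "fst p \<in> J n" if "p \<in> U n" for p n
      proof -
        define q where "q = (SOME p. p \<in> U n)"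
        have "q \<in> U n"
          unfolding q_def using that by (rule someI)
        then have "dist p q \<le> diameter (U n)"
          using U(2) that by (intro diameter_bounded_bound)
        then have "\<bar>fst p - fst q\<bar> \<le> diameter (U n)"
          using dist_fst_le[of p q] by (simp add: dist_real_def)
        then show ?thesis
          using that by (auto simp: J_def q_def[symmetric] Let_def abs_le_iff)
      qed
      have J_sets: "J n \<in> sets lborel" for n
        by (simp add: J_def Let_def)
      have J_le: "emeasure lborel (J n) \<le> 2 * diam_pow s (U n)" for n
      proof (cases "U n = {}")
        case False
        have d: "0 \<le> diameter (U n)"
          using U(2) by (rule diameter_ge_0)
        have "emeasure lborel (J n) = ennreal (2 * diameter (U n))"
          using False d by (simp add: J_def Let_def)
        also have "\<dots> = 2 * ennreal (diameter (U n))"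
          using d by (simp add: ennreal_mult)
        also have "ennreal (diameter (U n)) \<le> diam_pow s (U n)"
        proof (cases "s = 0")
          case True
          then show ?thesis
            using False U(3) by (simp add: diam_pow_def)
        next
          case s0: False
          have "diameter (U n) \<le> diameter (U n) powr s"
            using powr_mono'[of s 1 "diameter (U n)"] d U(3)[of n] \<open>\<not> 1 \<le> s\<close> by simp
          then show ?thesis
            using False s0 by (simp add: diam_pow_def ennreal_leI)
        qed
        finally show ?thesis
          by (simp add: mult_left_mono)
      qed (simp add: J_def)
      have "(1::ennreal) = emeasure lborel {0..1::real}"
        by simp
      also have "\<dots> \<le> emeasure lborel (\<Union>n. J n)"
      proof (rule emeasure_mono)
        show "{0..1} \<subseteq> (\<Union>n. J n)"
        proof
          fix t :: real assume "t \<in> {0..1}"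
          then obtain p where "p \<in> F" "t = fst p"
            using assms by blast
          then show "t \<in> (\<Union>n. J n)"
            using U(1) J_cover by blast
        qed
      qed (use J_sets in auto)
      also have "\<dots> \<le> (\<Sum>n. emeasure lborel (J n))"
        using J_sets by (intro emeasure_subadditive_countably) auto
      also have "\<dots> \<le> (\<Sum>n. 2 * diam_pow s (U n))"
        by (intro suminf_le J_le summableI)
      also have "\<dots> = 2 * (\<Sum>n. diam_pow s (U n))"
        by simp
      finally have *: "1 \<le> 2 * (\<Sum>n. diam_pow s (U n))" .
      show ?thesis
      proof (cases "(\<Sum>n. diam_pow s (U n))")
        case (real x)
        with * have "ennreal 1 \<le> ennreal (2 * x)"
          by (simp add: ennreal_mult)
        then show ?thesis
          using real ennreal_leI[of "1/2" x] by (subst (asm) ennreal_le_iff) auto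
      qed simp
    qed
    then have "ennreal (1/2) \<le> hausdorff_premeasure s 1 F"
      unfolding hausdorff_premeasure_def by (intro INF_greatest) auto
    also have "\<dots> \<le> hausdorff_measure s F"
      unfolding hausdorff_measure_def by (intro SUP_upper) simp
    finally show False
      using s(2) by simp
  qed
  then show ?thesis
    unfolding hausdorff_dim_def by (intro INF_greatest) auto
qed

text \<open>
  A Borel--Cantelli argument: the sets \<open>B w\<close> of level at least \<open>m\<close> cover \<open>E\<close>, and their
  diameters to the power \<open>s\<close> add up to at most the tail from \<open>m\<close> of a geometric series of ratio \<open>M * q powr s\<close>.
\<close>
lemma hausdorff_dim_limsup_le:
  fixes B :: "'w::countable \<Rightarrow> 'a::metric_space set" and L :: "'w \<Rightarrow> nat"
  assumes count: "\<And>n. finite {w \<in> W. L w = n}" "\<And>n. real (card {w \<in> W. L w = n}) \<le> M ^ n"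
    and diam: "\<And>w. w \<in> W \<Longrightarrow> bounded (B w)" "\<And>w. w \<in> W \<Longrightarrow> diameter (B w) \<le> c * q ^ L w"
    and const: "0 < c" "0 < q" "q < 1" "0 < s" "M * q powr s < 1"
    and limsup: "\<And>x n. x \<in> E \<Longrightarrow> \<exists>w\<in>W. n \<le> L w \<and> x \<in> B w"
  shows "hausdorff_dim E \<le> s"
proof -
  define \<theta> where "\<theta> = M * q powr s"
  have M: "0 \<le> M"
    using count(2)[of 1] by (simp add: order_trans[OF of_nat_0_le_iff])
  have \<theta>: "0 \<le> \<theta>" "\<theta> < 1"
    using const M by (auto simp: \<theta>_def)
  have tail: "hausdorff_premeasure s \<delta> E \<le> ennreal (c powr s * (\<theta> ^ m / (1 - \<theta>)))"
    if \<delta>: "0 < \<delta>" "c * q ^ m \<le> \<delta>" for \<delta> m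
  proof -
    define V where "V = {w \<in> W. m \<le> L w}"
    \<comment> \<open>Covers are sequences of sets, so the words are numbered and the unused indices filled with the empty set.\<close>
    define U where "U k = (if k \<in> to_nat ` V then B (from_nat k) else {})" for k
    have "E \<subseteq> (\<Union>k. U k)"
    proof
      fix x assume "x \<in> E"
      then obtain w where "w \<in> V" "x \<in> B w"
        using limsup[of x m] by (auto simp: V_def)
      then have "x \<in> U (to_nat w)"
        by (simp add: U_def)
      then show "x \<in> (\<Union>k. U k)"
        by blast
    qed
    moreover have "bounded (U k) \<and> diameter (U k) \<le> \<delta>" for k
    proof (cases "k \<in> to_nat ` V")
      case True
      then obtain w where w: "w \<in> W" "m \<le> L w" "k = to_nat w"
        by (auto simp: V_def)
      have "diameter (B w) \<le> c * q ^ L w"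
        using diam w by blast
      also have "\<dots> \<le> c * q ^ m"
        using const w(2) by (simp add: power_decreasing)
      finally show ?thesis
        using True w diam(1) \<delta> by (simp add: U_def)
    qed (use \<delta> in \<open>simp add: U_def\<close>)
    ultimately have "hausdorff_premeasure s \<delta> E \<le> (\<Sum>k. diam_pow s (U k))"
      unfolding hausdorff_premeasure_def by (intro INF_lower) auto
    also have "\<dots> \<le> ennreal (c powr s * (\<theta> ^ m / (1 - \<theta>)))"
    \<comment> \<open>Only finitely many words contribute to a partial sum; they are grouped by their level.\<close>
    proof (rule suminf_le_const[OF summableI])
      fix N
      define V' where "V' = {w \<in> V. to_nat w < N}"
      have fin: "finite V'"
        by (rule finite_subset[of _ "from_nat ` {..<N}"]) (auto simp: V'_def image_iff Bex_def intro!: exI[of _ "to_nat _"])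
      define M' where "M' = Max (insert m (L ` V'))"
      have M': "L w \<in> {m..M'}" if "w \<in> V'" for w
        using that fin by (auto simp: M'_def V'_def V_def)
      have "(\<Sum>k<N. diam_pow s (U k)) = (\<Sum>k\<in>to_nat ` V'. diam_pow s (U k))"
        by (rule sum.mono_neutral_right) (auto simp: V'_def U_def diam_pow_def)
      also have "\<dots> = (\<Sum>w\<in>V'. diam_pow s (B w))"
        by (subst sum.reindex) (auto simp: V'_def U_def intro!: sum.cong)
      also have "\<dots> \<le> (\<Sum>w\<in>V'. ennreal ((c * q ^ L w) powr s))"
      proof (rule sum_mono)
        fix w assume "w \<in> V'"
        then have "w \<in> W"
          by (simp add: V'_def V_def)
        then have "0 \<le> diameter (B w)" "diameter (B w) \<le> c * q ^ L w"
          using diam diameter_ge_0 by blast+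
        then have "diameter (B w) powr s \<le> (c * q ^ L w) powr s"
          using const(4) by (intro powr_mono2) auto
        then show "diam_pow s (B w) \<le> ennreal ((c * q ^ L w) powr s)"
          using const(4) by (auto simp: diam_pow_def intro: ennreal_leI)
      qed
      also have "\<dots> = ennreal (\<Sum>w\<in>V'. (c * q ^ L w) powr s)"
        by simp
      also have "\<dots> \<le> ennreal (c powr s * (\<theta> ^ m / (1 - \<theta>)))"
      proof (rule ennreal_leI)
        have "(\<Sum>w\<in>V'. (c * q ^ L w) powr s) = (\<Sum>n\<in>{m..M'}. \<Sum>w\<in>{w \<in> V'. L w = n}. (c * q ^ L w) powr s)"
          by (rule sum.group[symmetric]) (use fin M' in auto)
        also have "\<dots> \<le> (\<Sum>n\<in>{m..M'}. c powr s * \<theta> ^ n)"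
        proof (rule sum_mono)
          fix n
          have "(\<Sum>w\<in>{w \<in> V'. L w = n}. (c * q ^ L w) powr s)
              = real (card {w \<in> V'. L w = n}) * (c * q ^ n) powr s"
            by simp
          also have "\<dots> \<le> M ^ n * (c * q ^ n) powr s"
          proof (rule mult_right_mono)
            have "card {w \<in> V'. L w = n} \<le> card {w \<in> W. L w = n}"
              by (rule card_mono[OF count(1)]) (auto simp: V'_def V_def)
            then show "real (card {w \<in> V'. L w = n}) \<le> M ^ n"
              using count(2)[of n] by linarith
          qed simp
          also have "(c * q ^ n) powr s = c powr s * (q powr s) ^ n"
          proof -
            have "(q ^ n) powr s = q powr (real n * s)"
              using const by (simp add: powr_powr flip: powr_realpow)
            also have "\<dots> = (q powr s) ^ n"
              using const by (simp add: powr_power mult.commute)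
            finally show ?thesis
              using const by (simp add: powr_mult)
          qed
          finally show "(\<Sum>w\<in>{w \<in> V'. L w = n}. (c * q ^ L w) powr s) \<le> c powr s * \<theta> ^ n"
            by (simp add: \<theta>_def power_mult_distrib mult_ac)
        qed
        also have "\<dots> = c powr s * (\<Sum>n\<in>{m..M'}. \<theta> ^ n)"
          by (simp add: sum_distrib_left)
        also have "(\<Sum>n\<in>{m..M'}. \<theta> ^ n) \<le> \<theta> ^ m / (1 - \<theta>)"
          using \<theta> by (auto simp: sum_gp divide_right_mono)
        finally show "(\<Sum>w\<in>V'. (c * q ^ L w) powr s) \<le> c powr s * (\<theta> ^ m / (1 - \<theta>))"
          using const by (simp add: mult_left_mono)
      qed
      finally show "(\<Sum>k<N. diam_pow s (U k)) \<le> ennreal (c powr s * (\<theta> ^ m / (1 - \<theta>)))" .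
    qed
    finally show ?thesis .
  qed
  have "hausdorff_premeasure s \<delta> E = 0" if "0 < \<delta>" for \<delta>
  proof -
    have "(\<lambda>m. ennreal (c powr s * (\<theta> ^ m / (1 - \<theta>)))) \<longlonglongrightarrow> ennreal (c powr s * (0 / (1 - \<theta>)))"
      using \<theta> by (intro tendsto_intros LIMSEQ_power_zero) auto
    moreover have "\<forall>\<^sub>F m in sequentially. hausdorff_premeasure s \<delta> E \<le> ennreal (c powr s * (\<theta> ^ m / (1 - \<theta>)))"
    proof -
      have "(\<lambda>m. c * q ^ m) \<longlonglongrightarrow> c * 0"
        using const by (intro tendsto_intros LIMSEQ_power_zero) auto
      then have "\<forall>\<^sub>F m in sequentially. c * q ^ m < \<delta>"
        using that by (intro order_tendstoD(2)[where a = \<delta>]) auto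
      then show ?thesis
        by eventually_elim (use tail that in \<open>simp add: less_imp_le\<close>)
    qed
    ultimately have "hausdorff_premeasure s \<delta> E \<le> ennreal (c powr s * (0 / (1 - \<theta>)))"
      by (intro tendsto_lowerbound) auto
    then show ?thesis
      by simp
  qed
  then have "hausdorff_measure s E = 0"
    unfolding hausdorff_measure_def by (simp add: SUP_eq_const)
  then show ?thesis
    unfolding hausdorff_dim_def using const(4) by (intro INF_lower) auto
qed

section \<open>Attractors and cylinders\<close>

text \<open>
  The attractor is the intersection of the decreasing iterates \<open>A n\<close> of \<open>X\<close>. A point of the intersection
  lies in some \<open>T i ` A n\<close> for every \<open>n\<close>; by the pigeonhole principle one \<open>i\<close> serves for all \<open>n\<close>, and
  injectivity makes the preimage independent of \<open>n\<close>.
\<close>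
lemma attractor_exists:
  fixes T :: "'i \<Rightarrow> 'a::heine_borel \<Rightarrow> 'a"
  assumes "finite I" "I \<noteq> {}" "compact X" "X \<noteq> {}"
    and T: "\<And>i. i \<in> I \<Longrightarrow> continuous_on X (T i)" "\<And>i. i \<in> I \<Longrightarrow> inj_on (T i) X"
      "\<And>i. i \<in> I \<Longrightarrow> T i ` X \<subseteq> X"
  shows "\<exists>K\<subseteq>X. is_attractor I T K"
proof -
  define F where "F Y = (\<Union>i\<in>I. T i ` Y)" for Y
  define A where "A n = (F ^^ n) X" for n
  have A_simps: "A 0 = X" "\<And>n. A (Suc n) = F (A n)"
    by (auto simp: A_def)
  have F_mono: "F Y \<subseteq> F Z" if "Y \<subseteq> Z" for Y Z
    using that by (fastforce simp: F_def)
  have A_Suc: "A (Suc n) \<subseteq> A n" for n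
  proof (induction n)
    case 0
    then show ?case
      using T(3) by (auto simp: A_simps F_def)
  next
    case (Suc n)
    then show ?case
      using F_mono by (metis A_simps(2))
  qed
  have A_anti: "A n \<subseteq> A m" if "m \<le> n" for m n
    using lift_Suc_antimono_le[of A, OF A_Suc that] .
  have A_X: "A n \<subseteq> X" for n
    using A_anti[of 0 n] by (simp add: A_simps)
  have A_compact: "compact (A n) \<and> A n \<noteq> {}" for n
  proof (induction n)
    case (Suc n)
    have "compact (T i ` A n)" if "i \<in> I" for i
      using Suc T(1)[OF that] A_X continuous_on_subset by (blast intro: compact_continuous_image)
    then show ?case
      using Suc assms(1,2) by (auto simp: A_simps F_def)
  qed (use assms in \<open>simp add: A_simps\<close>)
  define K where "K = (\<Inter>n. A n)"
  have "K \<noteq> {}"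
    unfolding K_def using A_compact A_anti by (intro compact_nest) auto
  moreover have "compact K"
    unfolding K_def using A_compact by (intro compact_Inter) auto
  moreover have "F K \<subseteq> K"
  proof -
    have "F K \<subseteq> A n" for n
      using F_mono[of K "A n"] A_Suc[of n] by (auto simp: K_def A_simps)
    then show ?thesis
      by (auto simp: K_def)
  qed
  moreover have "K \<subseteq> F K"
  proof
    fix x assume x: "x \<in> K"
    have "\<forall>n. \<exists>i\<in>I. x \<in> T i ` A n"
      using x A_simps(2) by (fastforce simp: K_def F_def)
    then obtain f where f: "\<And>n. f n \<in> I" "\<And>n. x \<in> T (f n) ` A n"
      by metis
    have "finite (range f)"
      using f(1) assms(1) by (meson finite_subset image_subsetI)
    then obtain n0 where inf: "infinite {n. f n = f n0}"
      using pigeonhole_infinite[of UNIV f] by auto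
    define i where "i = f n0"
    have "x \<in> T i ` A n" for n
    proof -
      obtain k where "n \<le> k" "f k = i"
        using inf unfolding infinite_nat_iff_unbounded_le i_def by auto
      then show ?thesis
        using f(2)[of k] A_anti by blast
    qed
    then have "\<forall>n. \<exists>y. y \<in> A n \<and> x = T i y"
      by blast
    then obtain y where y: "\<And>n. y n \<in> A n" "\<And>n. x = T i (y n)"
      by metis
    have "y n = y 0" for n
      using T(2)[of i] f(1)[of n0] y A_X unfolding i_def inj_on_def by (metis subsetD)
    then have "y 0 \<in> K"
      using y(1) unfolding K_def by (metis INT_iff)
    then show "x \<in> F K"
      using y(2) f(1)[of n0] unfolding F_def i_def by blast
  qed
  ultimately have "is_attractor I T K"
    by (auto simp: is_attractor_def F_def)
  moreover have "K \<subseteq> X"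
    using A_X by (auto simp: K_def)
  ultimately show ?thesis
    by blast
qed

text \<open>
  The composition of the maps along a word \<open>v\<close> sends the unit square to the box with lower left corner
  \<open>(corner \<beta> d 1 v, corner \<beta> d 2 v)\<close> and side lengths \<open>side \<beta> 1 v\<close> and \<open>side \<beta> 2 v\<close>.
\<close>
primrec corner :: "('i \<Rightarrow> nat \<Rightarrow> real) \<Rightarrow> ('i \<Rightarrow> nat \<Rightarrow> real) \<Rightarrow> nat \<Rightarrow> 'i list \<Rightarrow> real" where
  "corner \<beta> d j [] = 0"
| "corner \<beta> d j (i # v) = coord_map \<beta> d i j (corner \<beta> d j v)"

definition side :: "('i \<Rightarrow> nat \<Rightarrow> real) \<Rightarrow> nat \<Rightarrow> 'i list \<Rightarrow> real" where
  "side \<beta> j v = (\<Prod>i\<leftarrow>v. \<beta> i j)"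

lemma side_simps [simp]:
  "side \<beta> j [] = 1" "side \<beta> j (i # v) = \<beta> i j * side \<beta> j v"
  "side \<beta> j (u @ v) = side \<beta> j u * side \<beta> j v"
  by (simp_all add: side_def)

lemma corner_append: "corner \<beta> d j (u @ v) = corner \<beta> d j u + side \<beta> j u * corner \<beta> d j v"
  by (induction u) (auto simp: coord_map_def algebra_simps)

lemma foldr_plane_map:
  "foldr (plane_map \<beta> d) v p =
     (corner \<beta> d 1 v + side \<beta> 1 v * fst p, corner \<beta> d 2 v + side \<beta> 2 v * snd p)"
  by (induction v) (auto simp: plane_map_def coord_map_def algebra_simps)

lemma corner_bounds:
  assumes "\<And>i. i \<in> D \<Longrightarrow> 0 < \<beta> i j \<and> 0 \<le> d i j \<and> d i j + \<beta> i j \<le> 1" "v \<in> lists D"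
  shows "0 < side \<beta> j v" "0 \<le> corner \<beta> d j v" "corner \<beta> d j v + side \<beta> j v \<le> 1"
proof -
  have "0 < side \<beta> j v \<and> 0 \<le> corner \<beta> d j v \<and> corner \<beta> d j v + side \<beta> j v \<le> 1"
    using assms(2)
  proof (induction v)
    case (Cons i v)
    then have i: "0 < \<beta> i j" "0 \<le> d i j" "d i j + \<beta> i j \<le> 1"
      using assms(1) by auto
    have "\<beta> i j * (corner \<beta> d j v + side \<beta> j v) \<le> \<beta> i j"
      using i(1) Cons by simp
    then show ?case
      using i Cons by (simp add: coord_map_def algebra_simps)
  qed simp
  then show "0 < side \<beta> j v" "0 \<le> corner \<beta> d j v" "corner \<beta> d j v + side \<beta> j v \<le> 1"
    by auto
qed

text \<open>
  At the first letter in which two incomparable words differ, the intervals do not overlap; applying the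
  increasing maps of the common prefix preserves this.
\<close>
lemma corner_separated:
  assumes unit: "\<And>i. i \<in> D \<Longrightarrow> 0 < \<beta> i j \<and> 0 \<le> d i j \<and> d i j + \<beta> i j \<le> 1"
    and sep: "\<And>i k. i \<in> D \<Longrightarrow> k \<in> D \<Longrightarrow> i \<noteq> k \<Longrightarrow> d i j + \<beta> i j \<le> d k j \<or> d k j + \<beta> k j \<le> d i j"
    and "u \<in> lists D" "v \<in> lists D" "\<not> prefix u v" "\<not> prefix v u"
  shows "corner \<beta> d j u + side \<beta> j u \<le> corner \<beta> d j v \<or>
         corner \<beta> d j v + side \<beta> j v \<le> corner \<beta> d j u"
  using assms(3-)
proof (induction u arbitrary: v)
  case (Cons i u)
  then obtain k w where v: "v = k # w"
    by (cases v) auto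
  have ik: "i \<in> D" "k \<in> D" "u \<in> lists D" "w \<in> lists D"
    using Cons.hyps Cons.prems(1) v by auto
  have pos: "0 < \<beta> i j" "0 < \<beta> k j"
    using unit ik by auto
  note bounds = corner_bounds[of D \<beta> j d, OF unit]
  show ?case
  proof (cases "i = k")
    case True
    then have "corner \<beta> d j u + side \<beta> j u \<le> corner \<beta> d j w \<or>
         corner \<beta> d j w + side \<beta> j w \<le> corner \<beta> d j u"
      using Cons.IH[OF ik(4)] Cons.prems(2,3) v by simp
    then have "\<beta> i j * (corner \<beta> d j u + side \<beta> j u) \<le> \<beta> i j * corner \<beta> d j w \<or>
         \<beta> i j * (corner \<beta> d j w + side \<beta> j w) \<le> \<beta> i j * corner \<beta> d j u"
      using pos by simp
    then show ?thesis
      using True v by (auto simp: coord_map_def algebra_simps)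
  next
    case False
    have "\<beta> i j * (corner \<beta> d j u + side \<beta> j u) \<le> \<beta> i j" "0 \<le> \<beta> i j * corner \<beta> d j u"
         "\<beta> k j * (corner \<beta> d j w + side \<beta> j w) \<le> \<beta> k j" "0 \<le> \<beta> k j * corner \<beta> d j w"
      using pos bounds[of u] bounds[of w] ik by simp_all
    then show ?thesis
      using sep[OF ik(1,2) False] v by (auto simp: coord_map_def algebra_simps)
  qed
qed simp

lemma foldr_in_attractor:
  assumes "is_attractor I T K" "v \<in> lists I" "p \<in> K"
  shows "foldr T v p \<in> K"
  using assms(2)
proof (induction v)
  case (Cons i v)
  then show ?case
    using assms(1) by (auto simp: is_attractor_def)
qed (use assms in simp)

lemma attractor_piece:
  assumes "is_attractor I T K" "x \<in> K"
  obtains i y where "i \<in> I" "y \<in> K" "x = T i y"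
  using assms unfolding is_attractor_def by blast

lemma attractor_word:
  assumes "is_attractor I T K" "x \<in> K"
  shows "\<exists>v p. v \<in> lists I \<and> length v = n \<and> p \<in> K \<and> x = foldr T v p"
  using assms(2)
proof (induction n arbitrary: x)
  case (Suc n)
  then obtain i y where iy: "i \<in> I" "y \<in> K" "x = T i y"
    using attractor_piece[OF assms(1)] by metis
  with Suc.IH[of y] obtain v p where "v \<in> lists I" "length v = n" "p \<in> K" "y = foldr T v p"
    by blast
  then show ?case
    using iy by (intro exI[of _ "i # v"] exI[of _ p]) auto
qed auto

section \<open>The three maps of the example\<close>

definition ratio :: "nat \<Rightarrow> nat \<Rightarrow> real" where
  "ratio i j = (if j = 1 then if i = 2 then 1/16 else 15/32 else 1/4)"

definition shift :: "nat \<Rightarrow> nat \<Rightarrow> real" where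
  "shift i j = (if j = 1 then 15/32 * real i else if i = 2 then 3/4 else 0)"

abbreviation letters :: "nat set" where "letters \<equiv> {0, 1, 2}"
abbreviation example_map :: "nat \<Rightarrow> real \<times> real \<Rightarrow> real \<times> real" where "example_map \<equiv> plane_map ratio shift"
abbreviation width :: "nat list \<Rightarrow> real" where "width \<equiv> side ratio 1"

lemma height: "side ratio 2 v = (1/4) ^ length v"
  by (induction v) (simp_all add: ratio_def)

lemma ratio_shift_unit: "i \<in> letters \<Longrightarrow> 0 < ratio i j \<and> 0 \<le> shift i j \<and> shift i j + ratio i j \<le> 1"
  by (auto simp: ratio_def shift_def)

lemma cylinder_bounds:
  assumes "v \<in> lists letters"
  shows "0 < side ratio j v" "0 \<le> corner ratio shift j v"
    "corner ratio shift j v + side ratio j v \<le> 1"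
  using corner_bounds[of letters ratio j shift v, OF ratio_shift_unit assms] by blast+

lemma columns_separated:
  assumes "u \<in> lists letters" "v \<in> lists letters" "\<not> prefix u v" "\<not> prefix v u"
  shows "corner ratio shift 1 u + width u \<le> corner ratio shift 1 v \<or>
         corner ratio shift 1 v + width v \<le> corner ratio shift 1 u"
  using ratio_shift_unit _ assms by (rule corner_separated) (auto simp: ratio_def shift_def)

lemma rows_separated:
  assumes "u \<in> lists {0, 2}" "v \<in> lists {0, 2}" "length u = n" "length v = n" "u \<noteq> v"
  shows "(1/4) ^ n \<le> \<bar>corner ratio shift 2 u - corner ratio shift 2 v\<bar>"
proof -
  have "\<not> prefix u v" "\<not> prefix v u"
    using assms(3-5) by (auto simp: prefix_def)
  with _ _ assms(1,2)
  have "corner ratio shift 2 u + side ratio 2 u \<le> corner ratio shift 2 v \<or>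
        corner ratio shift 2 v + side ratio 2 v \<le> corner ratio shift 2 u"
    by (rule corner_separated) (auto simp: ratio_def shift_def)
  then show ?thesis
    using assms(3,4) by (auto simp: height)
qed

lemma width_bounds:
  assumes "v \<in> lists letters"
  shows "(1/16) ^ length v \<le> width v" "width v \<le> (1/2) ^ length v"
proof -
  have "(1/16) ^ length v \<le> width v \<and> width v \<le> (1/2) ^ length v"
    using assms
  proof (induction v)
    case (Cons i v)
    then have "1/16 \<le> ratio i 1" "ratio i 1 \<le> 1/2"
      by (auto simp: ratio_def)
    moreover have "(1/16) ^ length v \<le> width v" "width v \<le> (1/2) ^ length v" "0 < width v"
      using Cons cylinder_bounds(1)[of v 1] by auto
    ultimately have "1/16 * (1/16) ^ length v \<le> ratio i 1 * width v"
        "ratio i 1 * width v \<le> 1/2 * (1/2) ^ length v"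
      by (intro mult_mono; simp)+
    then show ?case
      by simp
  qed simp
  then show "(1/16) ^ length v \<le> width v" "width v \<le> (1/2) ^ length v"
    by auto
qed

lemma example_attractor_exists:
  "\<exists>K. is_attractor letters example_map K \<and> K \<subseteq> {0..1} \<times> {0..1}"
proof -
  have "\<exists>K \<subseteq> {0..1} \<times> {0..1}. is_attractor letters example_map K"
  proof (rule attractor_exists)
    show "compact ({0..1::real} \<times> {0..1::real})"
      by (intro compact_Times) auto
    fix i assume i: "i \<in> letters"
    show "continuous_on ({0..1} \<times> {0..1}) (example_map i)"
      unfolding plane_map_def coord_map_def by (intro continuous_intros)
    show "inj_on (example_map i) ({0..1} \<times> {0..1})"
      using ratio_shift_unit[OF i, of 1] ratio_shift_unit[OF i, of 2]
      by (intro inj_onI) (simp add: plane_map_def coord_map_def prod_eq_iff)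
    show "example_map i ` ({0..1} \<times> {0..1}) \<subseteq> {0..1} \<times> {0..1}"
    proof -
      have "coord_map ratio shift i j t \<in> {0..1}" if "t \<in> {0..1}" for j t
      proof -
        have r: "0 < ratio i j" "0 \<le> shift i j" "shift i j + ratio i j \<le> 1"
          using ratio_shift_unit[OF i, of j] by auto
        have "0 \<le> ratio i j * t" "ratio i j * t \<le> ratio i j"
          using that r(1) by auto
        then show ?thesis
          using r unfolding coord_map_def atLeastAtMost_iff by linarith
      qed
      then show ?thesis
        by (force simp: plane_map_def)
    qed
  qed auto
  then show ?thesis
    by blast
qed

lemma coord_map_open_unit:
  "0 < \<beta> i j \<Longrightarrow> coord_map \<beta> d i j ` {0<..<1} = {d i j<..<d i j + \<beta> i j}"
proof -
  assume "0 < \<beta> i j"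
  then have "(\<lambda>t. \<beta> i j * t + d i j) ` {0<..<1} = {d i j<..<d i j + \<beta> i j}"
    by (intro set_eqI iffI)
       (auto simp: image_iff Bex_def field_simps intro!: exI[of _ "(_ - d i j) / \<beta> i j"])
  then show ?thesis
    by (simp add: coord_map_def[abs_def])
qed

text \<open>
  The column intervals of the three maps are pairwise disjoint. This settles both the disjointness of the
  open rectangles and the grid condition for the first coordinate; in the second coordinate there are only the
  intervals \<open>(0, 1/4)\<close> and \<open>(3/4, 1)\<close>.
\<close>
lemma example_is_baranski:
  assumes "is_attractor letters example_map K" "K \<subseteq> {0..1} \<times> {0..1}"
  shows "baranski_carpet K"
proof -
  have coord: "coord_map ratio shift i j ` {0<..<1} = {shift i j<..<shift i j + ratio i j}" if "i \<in> letters" for i j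
    using ratio_shift_unit[OF that] by (intro coord_map_open_unit) auto
  have disj: "{shift i 1<..<shift i 1 + ratio i 1} \<inter> {shift j 1<..<shift j 1 + ratio j 1} = {}"
    if "i \<in> letters" "j \<in> letters" "i \<noteq> j" for i j
    using that by (auto simp: shift_def ratio_def)
  have "example_map i ` ({0<..<1} \<times> {0<..<1}) \<inter> example_map j ` ({0<..<1} \<times> {0<..<1}) = {}"
    if "i \<in> letters" "j \<in> letters" "i \<noteq> j" for i j
  proof -
    have "fst ` example_map i ` ({0<..<1} \<times> {0<..<1}) \<subseteq> {shift i 1<..<shift i 1 + ratio i 1}" if "i \<in> letters" for i
      using coord[OF that, of 1] by (auto simp: plane_map_def)
    from this[OF that(1)] this[OF that(2)]
    have "fst p \<in> {}" if "p \<in> example_map i ` ({0<..<1} \<times> {0<..<1})" "p \<in> example_map j ` ({0<..<1} \<times> {0<..<1})" for p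
      unfolding disj[OF \<open>i \<in> letters\<close> \<open>j \<in> letters\<close> \<open>i \<noteq> j\<close>, symmetric] using that by blast
    then show ?thesis
      by blast
  qed
  moreover have "coord_map ratio shift i l ` {0<..<1} = coord_map ratio shift j l ` {0<..<1} \<or>
      coord_map ratio shift i l ` {0<..<1} \<inter> coord_map ratio shift j l ` {0<..<1} = {}"
    if "i \<in> letters" "j \<in> letters" "l \<in> {1, 2}" for i j l
  proof (cases "l = 1")
    case True
    then show ?thesis
      using disj[of i j] that coord by (cases "i = j") auto
  next
    case False
    then have "l = 2"
      using that by simp
    then show ?thesis
      using that(1,2) coord[OF that(1), of 2] coord[OF that(2), of 2]
      by (auto simp: shift_def ratio_def)
  qed
  ultimately have "baranski_system letters ratio shift K"
    unfolding baranski_system_def using assms by (auto simp: ratio_def)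
  then show ?thesis
    unfolding baranski_carpet_def by blast
qed

section \<open>Projection and box dimension of the carpet\<close>

locale example_carpet =
  fixes K :: "(real \<times> real) set"
  assumes attractor: "is_attractor letters example_map K"
    and unit_square: "K \<subseteq> {0..1} \<times> {0..1}"
begin

lemma point_bounds: "p \<in> K \<Longrightarrow> 0 \<le> fst p \<and> fst p \<le> 1 \<and> 0 \<le> snd p \<and> snd p \<le> 1"
  using unit_square by auto

text \<open>
  The columns fill \<open>[0, 1]\<close>, so every \<open>t\<close> lies in a column of level \<open>n\<close> for each \<open>n\<close>. Such a column
  contains the first coordinate of a point of \<open>K\<close> and has width at most \<open>(1/2) ^ n\<close>; compactness gives the rest.
\<close>
lemma projection_full: "{0..1} \<subseteq> fst ` K"
proof
  fix t :: real assume "t \<in> {0..1}"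
  have word: "\<exists>v \<in> lists letters. length v = n \<and> t \<in> {corner ratio shift 1 v..corner ratio shift 1 v + width v}"
    if "t \<in> {0..1}" for n t
    using that
  proof (induction n arbitrary: t)
    case (Suc n)
    define i :: nat where "i = (if t \<le> 15/32 then 0 else if t \<le> 15/16 then 1 else 2)"
    have i: "i \<in> letters" "0 < ratio i 1" "shift i 1 \<le> t" "t \<le> shift i 1 + ratio i 1"
      using Suc.prems by (auto simp: i_def shift_def ratio_def)
    then have "(t - shift i 1) / ratio i 1 \<in> {0..1}"
      by simp
    from Suc.IH[OF this] obtain v where v: "v \<in> lists letters" "length v = n"
      "(t - shift i 1) / ratio i 1 \<in> {corner ratio shift 1 v..corner ratio shift 1 v + width v}"
      by blast
    then have "t \<in> {corner ratio shift 1 (i # v)..corner ratio shift 1 (i # v) + width (i # v)}"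
      using i(2) by (simp add: coord_map_def field_simps)
    then show ?case
      using i(1) v by (intro bexI[of _ "i # v"]) auto
  qed auto
  obtain p where p: "p \<in> K"
    using attractor unfolding is_attractor_def by blast
  have "\<exists>y\<in>fst ` K. dist y t < e" if "0 < e" for e
  proof -
    obtain n where n: "(1/2) ^ n < e"
      using real_arch_pow_inv[OF \<open>0 < e\<close>, of "1/2"] by auto
    obtain v where v: "v \<in> lists letters" "length v = n"
      "t \<in> {corner ratio shift 1 v..corner ratio shift 1 v + width v}"
      using word[OF \<open>t \<in> {0..1}\<close>, of n] by blast
    define y where "y = foldr example_map v p"
    have y: "y \<in> K" "fst y = corner ratio shift 1 v + width v * fst p"
      using foldr_in_attractor[OF attractor v(1) p] by (auto simp: y_def foldr_plane_map)
    have "0 \<le> width v * fst p" "width v * fst p \<le> width v"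
      using cylinder_bounds(1)[OF v(1), of 1] point_bounds[OF p] by simp_all
    then have "dist (fst y) t \<le> width v"
      using v(3) unfolding dist_real_def abs_le_iff y(2) atLeastAtMost_iff by linarith
    also have "\<dots> < e"
      using width_bounds(2)[OF v(1)] v(2) n by simp
    finally show ?thesis
      using y(1) by blast
  qed
  then have "t \<in> closure (fst ` K)"
    by (auto simp: closure_approachable)
  moreover have "closed (fst ` K)"
    using attractor unfolding is_attractor_def
    by (intro compact_imp_closed compact_continuous_image continuous_intros) auto
  ultimately show "t \<in> fst ` K"
    by simp
qed

text \<open>
  This estimate says that \<open>K\<close> has box dimension at most \<open>1\<close>, in a form that passes to affine images and can be
  proved by induction: cut the image into \<open>3 ^ k\<close> boxes of height at most \<open>\<rho>\<close> and cover a box of width \<open>w'\<close> by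
  \<open>w' / \<rho> + 1\<close> balls. The widths add up to \<open>w\<close> because the three ratios in the first coordinate add up to \<open>1\<close>.
\<close>
lemma affine_image_cover:
  assumes "0 < \<rho>" "0 < w" "0 < h" "h * (1/4) ^ k \<le> \<rho>"
  shows "\<exists>A. finite A \<and> real (card A) \<le> w / \<rho> + 3 ^ k \<and>
    (\<lambda>p. (a + w * fst p, b + h * snd p)) ` K \<subseteq> (\<Union>c\<in>A. cball c \<rho>)"
  using assms(2-)
proof (induction k arbitrary: a b w h)
  case 0
  \<comment> \<open>The box is cut into squares of side \<open>\<rho>\<close> with centres \<open>c j\<close>.\<close>
  define c where "c j = (a + (real j + 1/2) * \<rho>, b + h / 2)" for j :: nat
  define A where "A = c ` {..nat \<lfloor>w / \<rho>\<rfloor>}"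
  have "card A \<le> nat \<lfloor>w / \<rho>\<rfloor> + 1"
    unfolding A_def using card_image_le[of "{..nat \<lfloor>w / \<rho>\<rfloor>}" c] by simp
  then have "real (card A) \<le> real (nat \<lfloor>w / \<rho>\<rfloor>) + 1"
    by linarith
  also have "real (nat \<lfloor>w / \<rho>\<rfloor>) \<le> w / \<rho>"
    using 0 \<open>0 < \<rho>\<close> by (intro of_nat_floor) simp
  finally have "real (card A) \<le> w / \<rho> + 3 ^ 0"
    by simp
  moreover have "(a + w * fst p, b + h * snd p) \<in> (\<Union>c\<in>A. cball c \<rho>)" if p: "p \<in> K" for p
  proof -
    define j where "j = nat \<lfloor>w * fst p / \<rho>\<rfloor>"
    have nonneg: "0 \<le> w * fst p / \<rho>" "w * fst p \<le> w"
      using 0 \<open>0 < \<rho>\<close> point_bounds[OF p] by auto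
    have "w * fst p / \<rho> \<le> w / \<rho>"
      using nonneg(2) \<open>0 < \<rho>\<close> by (simp add: divide_right_mono)
    then have "j \<le> nat \<lfloor>w / \<rho>\<rfloor>"
      unfolding j_def by (intro nat_mono floor_mono)
    then have "c j \<in> A"
      by (simp add: A_def)
    moreover have "dist (c j) (a + w * fst p, b + h * snd p) \<le> \<rho>"
    proof -
      have "real j \<le> w * fst p / \<rho>" "w * fst p / \<rho> \<le> real j + 1"
        using nonneg(1) unfolding j_def by linarith+
      then have "\<rho> * real j \<le> w * fst p" "w * fst p \<le> \<rho> * (real j + 1)"
        using \<open>0 < \<rho>\<close> by (simp_all add: field_simps)
      then have x: "\<bar>(real j + 1/2) * \<rho> - w * fst p\<bar> \<le> \<rho> / 2"
        unfolding abs_le_iff distrib_left distrib_right by (simp add: mult.commute)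
      have "0 \<le> h * snd p" "h * snd p \<le> h" "h \<le> \<rho>"
        using 0 point_bounds[OF p] by auto
      then have y: "\<bar>h / 2 - h * snd p\<bar> \<le> \<rho> / 2"
        unfolding abs_le_iff by linarith
      have "dist (c j) (a + w * fst p, b + h * snd p)
          \<le> \<bar>(real j + 1/2) * \<rho> - w * fst p\<bar> + \<bar>h / 2 - h * snd p\<bar>"
        unfolding c_def dist_Pair_Pair dist_real_def
        by (rule order_trans[OF sqrt_sum_squares_le_sum_abs]) simp
      then show ?thesis
        using x y by simp
    qed
    ultimately show ?thesis
      by auto
  qed
  ultimately show ?case
    by (intro exI[of _ A]) (auto simp: A_def)
next
  case (Suc k)
  \<comment> \<open>\<open>f i\<close> is the given affine map composed with the \<open>i\<close>-th map of the system.\<close>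
  define f where "f i p = (a + w * shift i 1 + w * ratio i 1 * fst p, b + h * shift i 2 + h / 4 * snd p)"
    for i and p :: "real \<times> real"
  have "\<forall>i\<in>letters. \<exists>A. finite A \<and> real (card A) \<le> w * ratio i 1 / \<rho> + 3 ^ k \<and> f i ` K \<subseteq> (\<Union>c\<in>A. cball c \<rho>)"
    unfolding f_def using Suc.prems ratio_shift_unit by (intro ballI Suc.IH) auto
  then obtain A where A: "\<And>i. i \<in> letters \<Longrightarrow> finite (A i)"
    "\<And>i. i \<in> letters \<Longrightarrow> real (card (A i)) \<le> w * ratio i 1 / \<rho> + 3 ^ k"
    "\<And>i. i \<in> letters \<Longrightarrow> f i ` K \<subseteq> (\<Union>c\<in>A i. cball c \<rho>)"
    by metis
  have "card (\<Union>i\<in>letters. A i) \<le> (\<Sum>i\<in>letters. card (A i))"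
    by (rule card_UN_le) simp
  then have "real (card (\<Union>i\<in>letters. A i)) \<le> (\<Sum>i\<in>letters. real (card (A i)))"
    by (metis of_nat_le_iff of_nat_sum)
  also have "\<dots> \<le> (\<Sum>i\<in>letters. w * ratio i 1 / \<rho> + 3 ^ k)"
    by (intro sum_mono A(2))
  also have "\<dots> = w / \<rho> + 3 ^ Suc k"
    by (simp add: ratio_def field_simps)
  finally have "real (card (\<Union>i\<in>letters. A i)) \<le> w / \<rho> + 3 ^ Suc k" .
  moreover have "(a + w * fst p, b + h * snd p) \<in> (\<Union>c\<in>(\<Union>i\<in>letters. A i). cball c \<rho>)" if "p \<in> K" for p
  proof -
    obtain i q where iq: "i \<in> letters" "q \<in> K" "p = example_map i q"
      by (rule attractor_piece[OF attractor \<open>p \<in> K\<close>])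
    then have f: "(a + w * fst p, b + h * snd p) = f i q"
      by (simp add: f_def plane_map_def coord_map_def ratio_def algebra_simps)
    have "f i q \<in> (\<Union>c\<in>A i. cball c \<rho>)"
      using iq(2) A(3)[OF iq(1)] by blast
    then show ?thesis
      unfolding f using iq(1) by blast
  qed
  moreover have "finite (\<Union>i\<in>letters. A i)"
    using A(1) by blast
  ultimately show ?case
    by blast
qed

text \<open>
  Take \<open>k\<close> least such that pieces \<open>k\<close> levels down have height at most \<open>r\<close>. Then \<open>4 ^ k \<le> 4 * R / r\<close>, so the number
  \<open>3 ^ k\<close> of pieces is not larger than \<open>4 * R / r\<close>; here it matters that the number of maps is at most the
  reciprocal of the common vertical ratio.
\<close>
lemma cylinder_cover:
  assumes v: "v \<in> lists letters" and "0 < r" "r \<le> R" "width v \<le> R" "(1/4) ^ length v \<le> R"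
  shows "\<exists>A. finite A \<and> real (card A) \<le> 5 * (R / r) \<and> foldr example_map v ` K \<subseteq> (\<Union>c\<in>A. cball c r)"
proof -
  define h :: real where "h = (1/4) ^ length v"
  have h: "0 < h" "h \<le> R"
    using assms by (auto simp: h_def)
  have "\<exists>k. h * (1/4) ^ k \<le> r"
    using real_arch_pow_inv[of "r / h" "1/4"] h \<open>0 < r\<close> by (auto simp: field_simps intro: less_imp_le)
  then obtain k where k: "h * (1/4) ^ k \<le> r" "\<And>l. l < k \<Longrightarrow> r < h * (1/4) ^ l"
    using exists_least_iff[of "\<lambda>k. h * (1/4) ^ k \<le> r"] by (auto simp: not_le)
  have "3 ^ k \<le> 4 * (R / r)"
  proof (cases k)
    case 0
    then show ?thesis
      using assms by (simp add: field_simps)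
  next
    case (Suc l)
    have "(3::real) ^ k \<le> 4 ^ k"
      by (intro power_mono) auto
    also have "\<dots> = 4 * (h / (h * (1/4) ^ l))"
      using h Suc by (simp add: power_one_over)
    also have "\<dots> \<le> 4 * (R / r)"
      using k(2)[of l] Suc h \<open>0 < r\<close> by (intro mult_left_mono frac_le) auto
    finally show ?thesis .
  qed
  moreover have "width v / r \<le> R / r"
    using assms by (simp add: divide_right_mono)
  moreover obtain A where A: "finite A" "real (card A) \<le> width v / r + 3 ^ k"
      "(\<lambda>p. (corner ratio shift 1 v + width v * fst p, corner ratio shift 2 v + h * snd p)) ` K \<subseteq> (\<Union>c\<in>A. cball c r)"
    using affine_image_cover[OF \<open>0 < r\<close> _ h(1) k(1)] cylinder_bounds(1)[OF v, of 1] by blast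
  ultimately show ?thesis
    by (intro exI[of _ A]) (auto simp: foldr_plane_map height h_def)
qed

section \<open>Cylinders of a given width\<close>

text \<open>
  Cylinders of one level have very different widths. Cutting every branch where its width first drops to
  \<open>R\<close> gives cylinders of width comparable to \<open>R\<close>.
\<close>
definition stopping_words :: "real \<Rightarrow> nat list set" where
  "stopping_words R = {v \<in> lists letters. width v \<le> R \<and> (\<forall>u. strict_prefix u v \<longrightarrow> R < width u)}"

lemma stopping_words_cover:
  assumes "x \<in> K" "0 < R"
  shows "\<exists>v\<in>stopping_words R. x \<in> foldr example_map v ` K"
proof -
  obtain n where n: "(1/2) ^ n < R"
    using real_arch_pow_inv[OF assms(2), of "1/2"] by auto
  obtain v p where v: "v \<in> lists letters" "length v = n" "p \<in> K" "x = foldr example_map v p"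
    using attractor_word[OF attractor assms(1)] by blast
  have "\<exists>m. width (take m v) \<le> R"
    using width_bounds(2)[OF v(1)] v(2) n by (intro exI[of _ n]) simp
  then obtain m where m: "width (take m v) \<le> R" "\<And>l. l < m \<Longrightarrow> R < width (take l v)"
    using exists_least_iff[of "\<lambda>m. width (take m v) \<le> R"] by (auto simp: not_le)
  have "R < width u" if "strict_prefix u (take m v)" for u
  proof -
    have "prefix u v"
      using that by (meson prefix_order.less_imp_le prefix_order.trans take_is_prefix)
    then have "u = take (length u) v"
      by (metis append_eq_conv_conj prefix_def)
    moreover have "length u < m"
      using prefix_length_less[OF that] by simp
    ultimately show ?thesis
      using m(2) by metis
  qed
  moreover have "take m v \<in> lists letters" "drop m v \<in> lists letters"
    using v(1) by (metis append_in_lists_conv append_take_drop_id)+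
  moreover have "x = foldr example_map (take m v) (foldr example_map (drop m v) p)"
    using v(4) by (metis append_take_drop_id foldr_append comp_apply)
  ultimately have "take m v \<in> stopping_words R" "x \<in> foldr example_map (take m v) ` K"
    using m(1) foldr_in_attractor[OF attractor, of "drop m v" p] v(3) by (simp_all add: stopping_words_def)
  then show ?thesis
    by blast
qed

lemma stopping_words_antichain:
  assumes "u \<in> stopping_words R" "v \<in> stopping_words R" "u \<noteq> v"
  shows "\<not> prefix u v"
proof
  assume "prefix u v"
  then have "strict_prefix u v"
    using assms(3) by (simp add: strict_prefix_def)
  then have "R < width u" "width u \<le> R"
    using assms(1,2) unfolding stopping_words_def by blast+
  then show False
    by simp
qed

lemma stopping_words_width:
  assumes "v \<in> stopping_words R" "R < 1"
  shows "R / 16 \<le> width v"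
proof (cases v rule: rev_cases)
  case Nil
  then show ?thesis
    using assms by (simp add: stopping_words_def)
next
  case (snoc u i)
  then have "R < width u" "i \<in> letters"
    using assms by (auto simp: stopping_words_def strict_prefix_def)
  moreover have "1/16 \<le> ratio i 1"
    using \<open>i \<in> letters\<close> by (auto simp: ratio_def)
  moreover have "0 < width u"
    using assms snoc by (intro cylinder_bounds(1)) (auto simp: stopping_words_def)
  ultimately have "R * (1/16) \<le> width u * ratio i 1"
    by (intro mult_mono) auto
  then show ?thesis
    using snoc by simp
qed

text \<open>
  The columns of distinct stopping words do not overlap and have width at least \<open>R / 16\<close>. So their
  left ends are \<open>R / 16\<close>-separated, and for cylinders meeting the ball they lie between \<open>fst x - 2 * R\<close> and
  \<open>fst x + R\<close>, which leaves at most \<open>48 + 1\<close> possibilities.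
\<close>
lemma card_stopping_words_near:
  fixes x :: "real \<times> real"
  assumes "0 < R" "R < 1"
  defines "V \<equiv> {v \<in> stopping_words R. foldr example_map v ` K \<inter> cball x R \<noteq> {}}"
  shows "finite V" "card V \<le> 49"
proof -
  \<comment> \<open>In units of \<open>R / 16\<close> the left ends are at least \<open>1\<close> apart, so their integer parts differ.\<close>
  define z where "z v = 16 * (corner ratio shift 1 v - fst x) / R" for v
  have "inj_on (\<lambda>v. \<lfloor>z v\<rfloor>) V"
  proof (rule inj_onI, rule ccontr)
    fix u v assume uv: "u \<in> V" "v \<in> V" "\<lfloor>z u\<rfloor> = \<lfloor>z v\<rfloor>" "u \<noteq> v"
    then have "\<not> prefix u v" "\<not> prefix v u"
      using stopping_words_antichain by (auto simp: V_def)
    moreover have "u \<in> lists letters" "v \<in> lists letters" "R / 16 \<le> width u" "R / 16 \<le> width v"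
      using uv stopping_words_width assms by (auto simp: V_def stopping_words_def)
    ultimately have "R / 16 \<le> \<bar>corner ratio shift 1 u - corner ratio shift 1 v\<bar>"
      using columns_separated[of u v] by linarith
    then have "1 \<le> 16 * \<bar>corner ratio shift 1 u - corner ratio shift 1 v\<bar> / R"
      using assms by (simp add: field_simps)
    also have "\<dots> = \<bar>16 * (corner ratio shift 1 u - corner ratio shift 1 v) / R\<bar>"
      using assms(1) by (simp only: abs_mult abs_divide abs_of_pos abs_numeral)
    also have "16 * (corner ratio shift 1 u - corner ratio shift 1 v) / R = z u - z v"
      by (simp add: z_def diff_divide_distrib right_diff_distrib)
    finally show False
      using uv(3) by linarith
  qed
  moreover have "(\<lambda>v. \<lfloor>z v\<rfloor>) ` V \<subseteq> {-32..16}"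
  proof (intro image_subsetI)
    fix v assume "v \<in> V"
    then obtain p where v: "v \<in> lists letters" "width v \<le> R" "p \<in> K" "dist x (foldr example_map v p) \<le> R"
      by (auto simp: V_def stopping_words_def)
    have "\<bar>fst x - (corner ratio shift 1 v + width v * fst p)\<bar> \<le> R"
      using v(4) dist_fst_le[of x "foldr example_map v p"] by (simp add: foldr_plane_map dist_real_def)
    moreover have "0 \<le> width v * fst p" "width v * fst p \<le> width v"
      using cylinder_bounds(1)[OF v(1), of 1] point_bounds[OF v(3)] by simp_all
    ultimately have "- 2 * R \<le> corner ratio shift 1 v - fst x" "corner ratio shift 1 v - fst x \<le> R"
      using v(2) by linarith+
    then have "-32 \<le> z v" "z v \<le> 16"
      using assms by (simp_all add: z_def field_simps)
    then show "\<lfloor>z v\<rfloor> \<in> {-32..16}"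
      by (simp add: le_floor_iff floor_le_iff)
  qed
  ultimately have "finite V \<and> card V \<le> card {-32..16::int}"
    by (meson card_inj_on_le finite_atLeastAtMost_int inj_on_finite)
  then show "finite V" "card V \<le> 49"
    by auto
qed

section \<open>Points near infinitely many tall cylinders\<close>

definition tall :: "nat list set" where
  "tall = {v \<in> lists letters. width v \<le> (1/4) ^ length v}"

text \<open>
  The neighbourhood of a cylinder whose radius is the height of the cylinder. With this radius, a ball of
  radius \<open>R\<close> about a point outside the neighbourhood can meet the cylinder only if its height is below \<open>R\<close>.
\<close>
definition nbhd :: "nat list \<Rightarrow> (real \<times> real) set" where
  "nbhd v = {x. \<exists>y \<in> foldr example_map v ` K. dist x y \<le> (1/4) ^ length v}"

definition often_near_tall :: "(real \<times> real) set" where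
  "often_near_tall = {x. \<forall>n. \<exists>v\<in>tall. n \<le> length v \<and> x \<in> nbhd v}"

lemma nbhd_diameter:
  assumes "v \<in> tall"
  shows "bounded (nbhd v)" "diameter (nbhd v) \<le> 4 * (1/4) ^ length v"
proof -
  have v: "v \<in> lists letters" "width v \<le> (1/4) ^ length v"
    using assms by (auto simp: tall_def)
  have cyl: "dist (foldr example_map v p) (foldr example_map v q) \<le> 2 * (1/4) ^ length v" if "p \<in> K" "q \<in> K" for p q
  proof -
    have "dist (foldr example_map v p) (foldr example_map v q) \<le> \<bar>width v * (fst p - fst q)\<bar> + \<bar>(1/4) ^ length v * (snd p - snd q)\<bar>"
      unfolding foldr_plane_map height dist_Pair_Pair dist_real_def
      by (rule order_trans[OF sqrt_sum_squares_le_sum_abs]) (simp add: algebra_simps)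
    also have "\<dots> = width v * \<bar>fst p - fst q\<bar> + (1/4) ^ length v * \<bar>snd p - snd q\<bar>"
      using cylinder_bounds(1)[OF v(1), of 1] by (simp add: abs_mult)
    also have "\<dots> \<le> width v * 1 + (1/4) ^ length v * 1"
      using cylinder_bounds(1)[OF v(1), of 1] point_bounds[OF that(1)] point_bounds[OF that(2)]
      by (intro add_mono mult_left_mono) (auto simp: abs_le_iff)
    finally show ?thesis
      using v(2) by simp
  qed
  have *: "dist x y \<le> 4 * (1/4) ^ length v" if xy: "x \<in> nbhd v" "y \<in> nbhd v" for x y
  proof -
    obtain p q where "p \<in> K" "q \<in> K" "dist x (foldr example_map v p) \<le> (1/4) ^ length v"
        "dist y (foldr example_map v q) \<le> (1/4) ^ length v"
      using xy unfolding nbhd_def by blast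
    then show ?thesis
      using cyl[of p q] dist_triangle[of x y "foldr example_map v p"]
        dist_triangle[of "foldr example_map v p" y "foldr example_map v q"] dist_commute[of y "foldr example_map v q"]
      by linarith
  qed
  then show "bounded (nbhd v)"
    unfolding bounded_two_points by blast
  show "diameter (nbhd v) \<le> 4 * (1/4) ^ length v"
    using * by (intro diameter_le) (auto simp: dist_norm)
qed

text \<open>
  There are at most \<open>3 ^ n\<close> tall words of length \<open>n\<close>, their neighbourhoods have diameter at most
  \<open>4 * (1/4) ^ n\<close>, and \<open>3 < 4 powr (4/5)\<close> since \<open>3 ^ 5 = 243 < 256 = 4 ^ 4\<close>.
\<close>
lemma often_near_tall_dim:
  assumes "E \<subseteq> often_near_tall"
  shows "hausdorff_dim E \<le> 4/5"
proof -
  have "hausdorff_dim E \<le> ereal (4/5)"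
  proof (rule hausdorff_dim_limsup_le)
    fix n
    have sub: "{v \<in> tall. length v = n} \<subseteq> {v. set v \<subseteq> letters \<and> length v = n}"
      by (auto simp: tall_def)
    have fin: "finite {v. set v \<subseteq> letters \<and> length v = n}"
      by (rule finite_lists_length_eq) simp
    show "finite {v \<in> tall. length v = n}"
      using sub fin by (rule finite_subset)
    have "card {v \<in> tall. length v = n} \<le> 3 ^ n"
      using card_mono[OF fin sub] card_lists_length_eq[of letters n] by (simp add: numeral_3_eq_3)
    then show "real (card {v \<in> tall. length v = n}) \<le> 3 ^ n"
      by (metis of_nat_le_iff of_nat_numeral of_nat_power)
  next
    show "bounded (nbhd v)" "diameter (nbhd v) \<le> 4 * (1/4) ^ length v" if "v \<in> tall" for v
      using nbhd_diameter[OF that] by auto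
    show "\<exists>v\<in>tall. n \<le> length v \<and> x \<in> nbhd v" if "x \<in> E" for x n
      using that assms by (auto simp: often_near_tall_def)
    have "((1/4) powr (4/5)) ^ 5 = (1/4 :: real) powr 4"
      by (simp add: powr_power)
    also have "\<dots> = (1/4) ^ 4"
      by (subst powr_realpow[symmetric]) auto
    finally have "(3 * (1/4::real) powr (4/5)) ^ 5 < 1 ^ 5"
      by (simp add: power_mult_distrib power_divide)
    then show "3 * (1/4::real) powr (4/5) < 1"
      by (rule power_less_imp_less_base) simp
  qed auto
  then show ?thesis
    by simp
qed

text \<open>
  At small scales \<open>R\<close>, the cylinders of width comparable to \<open>R\<close> that meet the ball are either not tall or, being far
  from \<open>x\<close> relative to their height, lower than \<open>R\<close>. Either way both sides are at most \<open>R\<close>, and each of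
  the at most \<open>49\<close> cylinders is covered by \<open>5 * R / r\<close> balls.
\<close>
lemma pointwise_dim_le_1:
  assumes "x \<notin> often_near_tall"
  shows "pointwise_assouad_dim K x \<le> 1"
proof -
  obtain n where n: "\<And>v. v \<in> tall \<Longrightarrow> n \<le> length v \<Longrightarrow> x \<notin> nbhd v"
    using assms by (auto simp: often_near_tall_def)
  have bound: "real (covering_number r (cball x R \<inter> K)) \<le> 245 * (R / r) powr 1"
    \<comment> \<open>Widths are at least \<open>(1/16) ^ length v\<close>, so below this scale all words have length at least \<open>n\<close>.\<close>
    if r: "0 < r" "r \<le> R" "R < (1/16) ^ n" for r R
  proof -
    have "(1/16) ^ n \<le> (1::real)"
      by (simp add: power_le_one)
    then have R: "0 < R" "R < 1"
      using r by linarith+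
    define V where "V = {v \<in> stopping_words R. foldr example_map v ` K \<inter> cball x R \<noteq> {}}"
    have V: "finite V" "card V \<le> 49"
      unfolding V_def using card_stopping_words_near[OF R] by auto
    have "\<exists>A. finite A \<and> real (card A) \<le> 5 * (R / r) \<and> foldr example_map v ` K \<subseteq> (\<Union>c\<in>A. cball c r)"
      if "v \<in> V" for v
    proof (rule cylinder_cover[OF _ r(1,2)])
      show v: "v \<in> lists letters" "width v \<le> R"
        using that by (auto simp: V_def stopping_words_def)
      show "(1/4) ^ length v \<le> R"
      proof (rule ccontr)
        assume high: "\<not> (1/4) ^ length v \<le> R"
        obtain y where y: "y \<in> foldr example_map v ` K" "dist x y \<le> R"
          using \<open>v \<in> V\<close> unfolding V_def cball_def by blast
        have "v \<in> tall"
          using high v by (simp add: tall_def)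
        moreover have "dist x y \<le> (1/4) ^ length v"
          using high y(2) by linarith
        then have "x \<in> nbhd v"
          using y(1) unfolding nbhd_def by blast
        moreover have "(1/16::real) ^ length v < (1/16) ^ n"
          using width_bounds(1)[OF v(1)] v(2) r(3) by linarith
        then have "n \<le> length v"
          using power_decreasing[of "length v" n "1/16::real"] by (intro leI notI) auto
        ultimately show False
          using n by blast
      qed
    qed
    then obtain A where A: "\<And>v. v \<in> V \<Longrightarrow> finite (A v)"
        "\<And>v. v \<in> V \<Longrightarrow> real (card (A v)) \<le> 5 * (R / r)"
        "\<And>v. v \<in> V \<Longrightarrow> foldr example_map v ` K \<subseteq> (\<Union>c\<in>A v. cball c r)"
      by metis
    have "cball x R \<inter> K \<subseteq> (\<Union>c\<in>(\<Union>v\<in>V. A v). cball c r)"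
    proof
      fix y assume y: "y \<in> cball x R \<inter> K"
      then obtain v where "v \<in> stopping_words R" "y \<in> foldr example_map v ` K"
        using stopping_words_cover R by blast
      moreover from this have "v \<in> V"
        using y by (auto simp: V_def)
      ultimately show "y \<in> (\<Union>c\<in>(\<Union>v\<in>V. A v). cball c r)"
        using A(3)[of v] by blast
    qed
    then have "covering_number r (cball x R \<inter> K) \<le> card (\<Union>v\<in>V. A v)"
      using V(1) A(1) by (intro covering_number_le_card) auto
    also have "\<dots> \<le> (\<Sum>v\<in>V. card (A v))"
      using V(1) by (rule card_UN_le)
    finally have "real (covering_number r (cball x R \<inter> K)) \<le> (\<Sum>v\<in>V. real (card (A v)))"
      by (metis of_nat_le_iff of_nat_sum)
    also have "\<dots> \<le> real (card V) * (5 * (R / r))"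
      using A(2) by (rule sum_bounded_above)
    also have "\<dots> \<le> 49 * (5 * (R / r))"
      using V(2) r by (intro mult_right_mono) auto
    finally show ?thesis
      using r by (simp add: R)
  qed
  have "pointwise_assouad_dim K x \<le> ereal 1"
    unfolding pointwise_assouad_dim_def
  proof (rule INF_lower, rule CollectI)
    show "\<exists>C>0. \<exists>\<rho>>0. \<forall>r R. 0 < r \<longrightarrow> r \<le> R \<longrightarrow> R < \<rho> \<longrightarrow>
        real (covering_number r (cball x R \<inter> K)) \<le> C * (R / r) powr 1"
      using bound by (intro exI[of _ 245] exI[of _ "(1/16) ^ n"] conjI allI impI) auto
  qed
  then show ?thesis
    by (simp add: one_ereal_def)
qed

section \<open>The Assouad dimension of the carpet\<close>

text \<open>
  Consider the words \<open>2 ^ n @ v @ u\<close>, that is, \<open>n\<close> copies of the letter \<open>2\<close> followed by a word \<open>v\<close> of length \<open>n\<close> in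
  the two bottom maps and a word \<open>u\<close> of length \<open>l\<close> that chooses between the rows. After \<open>2 ^ n @ v\<close> the cylinder
  has height \<open>4 ^ (-2 * n) = 16 ^ (-n) = R\<close>, while the first \<open>n\<close> letters alone already force the width down to \<open>R\<close>: all these
  cylinders lie in one square of side \<open>R\<close>. Different \<open>u\<close> are told apart vertically at distance
  \<open>R * (1/4) ^ l = R * (1/2) ^ n\<close> and different \<open>v\<close> horizontally at distance \<open>R * (15/32) ^ n\<close>; with
  \<open>n = 2 * l\<close> the second distance is at most the first. There are \<open>2 ^ n * 2 ^ l = 8 ^ l\<close> such words.
\<close>
lemma product_like_piece:
  assumes "n = 2 * l"
  defines "R \<equiv> (1/16 :: real) ^ n"
  defines "r \<equiv> R * (15/32) ^ n / 3"
  shows "\<exists>x\<in>K. 8 ^ l \<le> covering_number r (cball x (2 * R) \<inter> K)"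
proof -
  define lv where "lv A m = {v :: nat list. set v \<subseteq> A \<and> length v = m}" for A m
  obtain q where q: "q \<in> K"
    using attractor unfolding is_attractor_def by blast
  define f where "f vu = foldr example_map (replicate n 2 @ fst vu @ snd vu) q" for vu
  define S where "S = lv {0, 1} n \<times> lv {0, 2} l"
  have row: "corner ratio shift 2 v = 0" "width v = (15/32) ^ length v" if "set v \<subseteq> {0, 1}" for v
    using that by (induction v) (auto simp: coord_map_def ratio_def shift_def)
  have stack: "width (replicate m 2) = (1/16) ^ m" for m
    by (induction m) (auto simp: ratio_def)
  have R: "0 < R" "R = (1/4) ^ n * (1/4) ^ n"
    by (simp_all add: R_def flip: power_mult_distrib)
  have words: "v \<in> lists letters" "length v = n" "u \<in> lists {0, 2}" "u \<in> lists letters" "length u = l"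
    if "(v, u) \<in> S" for v u
    using that by (auto simp: S_def lv_def)
  have fst_f: "fst (f (v, u)) = corner ratio shift 1 (replicate n 2)
      + R * (corner ratio shift 1 v + (15/32) ^ n * (corner ratio shift 1 u + width u * fst q))"
    if "(v, u) \<in> S" for v u
    using that row(2)[of v] unfolding f_def foldr_plane_map fst_conv snd_conv corner_append side_simps stack
    by (simp add: R_def S_def lv_def algebra_simps)
  have snd_f: "snd (f (v, u)) = corner ratio shift 2 (replicate n 2)
      + R * (corner ratio shift 2 u + (1/4) ^ l * snd q)"
    if "(v, u) \<in> S" for v u
    using that row(1)[of v] unfolding f_def foldr_plane_map fst_conv snd_conv corner_append side_simps height
    by (simp add: R(2) S_def lv_def algebra_simps)
  have f_K: "f z \<in> K" if "z \<in> S" for z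
    using that words[of "fst z" "snd z"] unfolding f_def by (intro foldr_in_attractor[OF attractor _ q]) auto
  have sep: "3 * r \<le> dist (f z) (f z')" if "z \<in> S" "z' \<in> S" "z \<noteq> z'" for z z'
  proof -
    obtain v u v' u' where z: "z = (v, u)" "z' = (v', u')"
      by (metis surj_pair)
    note S = that[unfolded z]
    note w = words[OF S(1)] words[OF S(2)]
    show ?thesis
    proof (cases "u = u'")
      case False
      have "(15/32 :: real) ^ n \<le> (1/2) ^ n"
        by (intro power_mono) auto
      also have "\<dots> = (1/4) ^ l"
        by (simp add: assms(1) power_mult power2_eq_square)
      also have "\<dots> \<le> \<bar>corner ratio shift 2 u - corner ratio shift 2 u'\<bar>"
        using rows_separated[OF w(3) w(8) w(5) w(10) False] .
      finally have "3 * r \<le> R * \<bar>corner ratio shift 2 u - corner ratio shift 2 u'\<bar>"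
        using R(1) by (simp add: r_def)
      also have "\<dots> = \<bar>snd (f z) - snd (f z')\<bar>"
        using R(1) by (simp add: z snd_f S abs_mult flip: right_diff_distrib)
      also have "\<dots> \<le> dist (f z) (f z')"
        using dist_snd_le[of "f z" "f z'"] by (simp add: dist_real_def)
      finally show ?thesis .
    next
      case True
      then have "v \<noteq> v'"
        using S(3) by auto
      then have "\<not> prefix v v'" "\<not> prefix v' v"
        using w by (auto simp: prefix_def)
      moreover have "width v = (15/32) ^ n" "width v' = (15/32) ^ n"
        using S row(2) by (auto simp: S_def lv_def)
      ultimately have "(15/32) ^ n \<le> \<bar>corner ratio shift 1 v - corner ratio shift 1 v'\<bar>"
        using columns_separated[OF w(1) w(6)] by linarith
      then have "3 * r \<le> R * \<bar>corner ratio shift 1 v - corner ratio shift 1 v'\<bar>"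
        using R(1) by (simp add: r_def)
      also have "\<dots> = \<bar>fst (f z) - fst (f z')\<bar>"
      proof -
        have "fst (f z) - fst (f z') = R * (corner ratio shift 1 v - corner ratio shift 1 v')"
          unfolding z fst_f[OF S(1)] fst_f[OF S(2)] by (simp add: True algebra_simps)
        then show ?thesis
          using R(1) by (simp add: abs_mult)
      qed
      also have "\<dots> \<le> dist (f z) (f z')"
        using dist_fst_le[of "f z" "f z'"] by (simp add: dist_real_def)
      finally show ?thesis .
    qed
  qed
  have near: "dist (f z) (f z') \<le> 2 * R" if "z \<in> S" "z' \<in> S" for z z'
  proof -
    have in_box: "fst (f z) \<in> {a..a + R} \<and> snd (f z) \<in> {b..b + R}"
      if "z \<in> S" and ab: "a = corner ratio shift 1 (replicate n 2)" "b = corner ratio shift 2 (replicate n 2)"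
      for z a b
    proof -
      obtain v u where z: "z = (v, u)"
        by (metis surj_pair)
      note S = \<open>z \<in> S\<close>[unfolded z]
      note w = words[OF S]
      define p where "p = foldr example_map (v @ u) q"
      have "p \<in> K"
        unfolding p_def using w by (intro foldr_in_attractor[OF attractor _ q]) auto
      then have p: "0 \<le> fst p" "fst p \<le> 1"
        using point_bounds by auto
      have "fst (f z) = a + R * fst p"
        using fst_f[OF S] row(2)[of v] S
        unfolding p_def foldr_plane_map fst_conv corner_append side_simps
        by (simp add: z ab S_def lv_def algebra_simps)
      moreover have "snd (f z) = b + R * (corner ratio shift 2 u + (1/4) ^ l * snd q)"
        using snd_f[OF S] by (simp add: z ab)
      moreover have "0 \<le> (1/4) ^ l * snd q" "(1/4) ^ l * snd q \<le> (1/4) ^ l"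
        using point_bounds[OF q] by auto
      then have "0 \<le> corner ratio shift 2 u + (1/4) ^ l * snd q" "corner ratio shift 2 u + (1/4) ^ l * snd q \<le> 1"
        using cylinder_bounds(2,3)[OF w(4), of 2] unfolding height w(5) by linarith+
      ultimately show ?thesis
        using p R(1) by auto
    qed
    have "dist (f z) (f z') \<le> \<bar>fst (f z) - fst (f z')\<bar> + \<bar>snd (f z) - snd (f z')\<bar>"
      unfolding dist_prod_def dist_real_def
      by (rule order_trans[OF sqrt_sum_squares_le_sum_abs]) simp
    also have "\<dots> \<le> 2 * R"
      using in_box[OF that(1) refl refl] in_box[OF that(2) refl refl] by (auto simp: abs_le_iff)
    finally show ?thesis .
  qed
  have "0 < r"
    using R(1) by (simp add: r_def)
  have "inj_on f S"
  proof (rule inj_onI, rule ccontr)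
    fix z z' assume "z \<in> S" "z' \<in> S" "f z = f z'" "z \<noteq> z'"
    then show False
      using sep[of z z'] \<open>0 < r\<close> by simp
  qed
  then have "card (f ` S) = card S"
    by (rule card_image)
  also have "\<dots> = 2 ^ n * 2 ^ l"
    unfolding S_def lv_def by (simp add: card_cartesian_product card_lists_length_eq numeral_2_eq_2)
  also have "\<dots> = 8 ^ l"
    by (simp add: assms(1) power_mult flip: power_mult_distrib)
  finally have card: "card (f ` S) = 8 ^ l" .
  have "(replicate n 0, replicate l 0) \<in> S"
    by (auto simp: S_def lv_def)
  then obtain z where z: "z \<in> S"
    by blast
  have "card (f ` S) \<le> covering_number r (cball (f z) (2 * R) \<inter> K)"
  proof (rule card_separated_le_covering_number)
    show "f ` S \<subseteq> cball (f z) (2 * R) \<inter> K"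
      using near[OF z] f_K by auto
    fix p p' assume "p \<in> f ` S" "p' \<in> f ` S" "p \<noteq> p'"
    then show "2 * r < dist p p'"
      using sep \<open>0 < r\<close> by force
  qed (use \<open>0 < r\<close> in \<open>auto simp: bounded_Int\<close>)
  then show ?thesis
    using card f_K[OF z] by auto
qed

text \<open>
  With \<open>R / r\<close> growing like \<open>(32/15) ^ (2 * l) = (1024/225) ^ l\<close>, an admissible exponent \<open>s\<close> must satisfy
  \<open>8 \<le> (1024/225) powr s\<close>, whereas \<open>(1024/225) ^ 6 < 8 ^ 5\<close>.
\<close>
lemma assouad_dim_ge: "6/5 \<le> assouad_dim K"
proof -
  have "6/5 \<le> s"
    if "0 < C" and bound: "\<And>r R x. 0 < r \<Longrightarrow> r \<le> R \<Longrightarrow> R < 1 \<Longrightarrow> x \<in> K \<Longrightarrow>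
       real (covering_number r (cball x R \<inter> K)) \<le> C * (R / r) powr s" for s C
  proof (rule ccontr)
    assume "\<not> 6/5 \<le> s"
    define \<gamma> where "\<gamma> = (1024/225 :: real) powr (6/5)"
    have "\<gamma> ^ 5 = (1024/225) powr 6"
      by (simp add: \<gamma>_def powr_power)
    also have "\<dots> = (1024/225) ^ 6"
      by (subst powr_realpow[symmetric]) auto
    finally have "\<gamma> ^ 5 < 8 ^ 5"
      by (simp add: power_divide)
    then have \<gamma>: "0 < \<gamma>" "\<gamma> < 8"
      using power_less_imp_less_base[of \<gamma> 5 8] by (auto simp: \<gamma>_def)
    have growth: "(8 / \<gamma>) ^ l \<le> C * 6 powr (6/5)" if "1 \<le> l" for l
    proof -
      define n where "n = 2 * l"
      define R where "R = (1/16 :: real) ^ n"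
      define r where "r = R * (15/32) ^ n / 3"
      have R: "0 < R" "R \<le> 1/16"
        using power_decreasing[of 1 n "1/16::real"] that by (auto simp: R_def n_def)
      obtain x where x: "x \<in> K" "8 ^ l \<le> covering_number r (cball x (2 * R) \<inter> K)"
        using product_like_piece[OF n_def] unfolding r_def R_def by blast
      have "(15/32 :: real) ^ n \<le> 1"
        by (simp add: power_le_one)
      then have "R * (15/32) ^ n \<le> R"
        using R(1) by simp
      then have "r \<le> 2 * R"
        using R(1) unfolding r_def by linarith
      moreover have "0 < r"
        using R(1) by (simp add: r_def)
      ultimately have r: "0 < r" "r \<le> 2 * R"
        by auto
      have scale: "2 * R / r = 6 * (1024/225) ^ l"
        using R(1) by (simp add: r_def n_def power_mult power_divide power2_eq_square)
      have "8 ^ l \<le> real (covering_number r (cball x (2 * R) \<inter> K))"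
        using x(2) by (metis of_nat_le_iff of_nat_numeral of_nat_power)
      also have "\<dots> \<le> C * (2 * R / r) powr s"
        using r R x(1) by (intro bound) auto
      also have "\<dots> \<le> C * (2 * R / r) powr (6/5)"
        using \<open>0 < C\<close> r \<open>\<not> 6/5 \<le> s\<close> by (intro mult_left_mono powr_mono) auto
      also have "(2 * R / r) powr (6/5) = 6 powr (6/5) * \<gamma> ^ l"
        unfolding scale \<gamma>_def
        by (simp add: powr_mult powr_power powr_powr mult.commute flip: powr_realpow)
      finally show ?thesis
        using \<gamma> by (simp add: power_divide field_simps)
    qed
    obtain l where l: "C * 6 powr (6/5) < (8 / \<gamma>) ^ l"
      using real_arch_pow[of "8 / \<gamma>"] \<gamma> by auto
    also have "\<dots> \<le> (8 / \<gamma>) ^ Suc l"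
      using \<gamma> by (intro power_increasing) auto
    finally show False
      using growth[of "Suc l"] by simp
  qed
  then have "ereal (6/5) \<le> assouad_dim K"
    unfolding assouad_dim_def by (intro INF_greatest) auto
  then show ?thesis
    by simp
qed

lemma maximal_points_dim:
  "hausdorff_dim {x \<in> K. pointwise_assouad_dim K x = assouad_dim K} < hausdorff_dim K"
proof -
  have "{x \<in> K. pointwise_assouad_dim K x = assouad_dim K} \<subseteq> often_near_tall"
  proof (rule subsetI, rule ccontr)
    fix x assume "x \<in> {x \<in> K. pointwise_assouad_dim K x = assouad_dim K}" "x \<notin> often_near_tall"
    then have "6/5 \<le> (1::ereal)"
      using assouad_dim_ge pointwise_dim_le_1[of x] by (metis (mono_tags) mem_Collect_eq order_trans)
    then show False
      by simp
  qed
  then have "hausdorff_dim {x \<in> K. pointwise_assouad_dim K x = assouad_dim K} \<le> 4/5"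
    by (rule often_near_tall_dim)
  also have "(4/5::ereal) < 1"
    by simp
  also have "1 \<le> hausdorff_dim K"
    using projection_full by (rule hausdorff_dim_ge_1_if_projection_full)
  finally show ?thesis .
qed

end

theorem theoremB:
  "\<exists>K. baranski_carpet K \<and>
       hausdorff_dim {x \<in> K. pointwise_assouad_dim K x = assouad_dim K} < hausdorff_dim K"
proof -
  obtain K where K: "is_attractor letters example_map K" "K \<subseteq> {0..1} \<times> {0..1}"
    using example_attractor_exists by blast
  interpret example_carpet K
    using K by unfold_locales
  show ?thesis
    using example_is_baranski[OF K] maximal_points_dim by blast
qed

end
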